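(* Let $P\subseteq\mathbb{T}^d$ be a canonical tropical lattice polytope, i.e. a tropical polytope all of whose vertices lie in $(\mathbb{Z}_{\ge0}\cup\{-\infty\})^d$. Then the counting function $k\mapsto\#(k\cdot P\cap\mathbb{Z}^d)$, where $k\cdot P=\{kx:x\in P\}$ is the ordinary (classical) dilate, agrees with a polynomial of degree $\dim(P)$ in $k$ for all positive integers $k$.
   Context: $\mathbb{T}=\mathbb{R}\cup\{-\infty\}$ with $x\oplus y=\max(x,y)$, $x\odot y=x+y$. For $V\subseteq\mathbb{T}^d$, $\mathrm{tconv}(V)=\{\bigoplus_{j=1}^n\lambda_j\odot v_j:\lambda_j\in\mathbb{T},\ \bigoplus_j\lambda_j=0,\ v_j\in V\}$. A tropical polytope is $\mathrm{tconv}(V)$ for a finite set $V$; its vertices are the elements of its unique minimal generating set. In the dilate, $k\cdot(-\infty)=-\infty$ for positive integers $k$. Covector decomposition: let $v_1,\dots,v_n$ be the vertices of $P$, $v_j=(v_{1j},\dots,v_{dj})$, and put $v_{0j}=0$, $x_0=0$. For $G\subseteq\{0,\dots,d\}\times[n]$ let $C_G=\{x\in\mathbb{T}^d: v_{kj}+x_i\le v_{ij}+x_k\text{ for all }(i,j)\in G,\ k\in\{0,\dots,d\}\}$. The closed cells of the covector decomposition of $P$ are the nonempty $C_G$ for which every $i\in\{0,\dots,d\}$ occurs in some $(i,j)\in G$ and every $j\in[n]$ occurs in some $(i,j)\in G$ with $v_{ij}\ne-\infty$. Their union is $P$, and their images under $x\mapsto(b^{x_1},\dots,b^{x_d})$ ($b>1$,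 $b^{-\infty}=0$) are convex polytopes forming a polyhedral complex; the dimension of a cell is the dimension of its image. $\dim(P)$ is the maximal dimension of a cell.
   Formalization: The formal statement additionally assumes that P∩Z^d is finite and nonempty (equivalently, P is nonempty and no vertex has a coordinate −∞); without this the claim fails, e.g. P=tconv{−∞,0} in T^1 contains infinitely many integers. *)

theory Defs
  imports "HOL-Analysis.Analysis" "HOL-Computational_Algebra.Polynomial"
begin

text \<open>
  The tropical semiring is the set of extended reals other than \<open>\<infinity>\<close>, with \<open>max\<close> as addition and \<open>+\<close>
  as multiplication. Finite tropical sums are written as suprema: the empty one is
  \<open>-\<infinity>\<close>, the tropical zero.
\<close>

definition trop :: "ereal set" where
  "trop = {x. x \<noteq> \<infinity>}"

definition trop_space :: "(ereal^'d) set" where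
  "trop_space = {x. \<forall>i. x $ i \<in> trop}"

definition tconv :: "(ereal^'d) set \<Rightarrow> (ereal^'d) set" where
  "tconv V =
    {x. \<exists>(n::nat) c v.
          (\<forall>j\<in>{1..n}. c j \<in> trop \<and> v j \<in> V) \<and>
          (SUP j\<in>{1..n}. c j) = 0 \<and>
          x = (\<chi> i. SUP j\<in>{1..n}. c j + v j $ i)}"

definition tropical_polytope :: "(ereal^'d) set \<Rightarrow> bool" where
  "tropical_polytope P \<longleftrightarrow> (\<exists>V. finite V \<and> V \<subseteq> trop_space \<and> P = tconv V)"

definition minimal_generating_set :: "(ereal^'d) set \<Rightarrow> (ereal^'d) set \<Rightarrow> bool" where
  "minimal_generating_set P V \<longleftrightarrow>
     V \<subseteq> trop_space \<and> tconv V = P \<and> (\<forall>W. W \<subset> V \<longrightarrow> tconv W \<noteq> P)"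

definition tvertices :: "(ereal^'d) set \<Rightarrow> (ereal^'d) set" where
  "tvertices P = (THE V. minimal_generating_set P V)"

definition canonical_tropical_lattice_polytope :: "(ereal^'d) set \<Rightarrow> bool" where
  "canonical_tropical_lattice_polytope P \<longleftrightarrow>
     tropical_polytope P \<and>
     (\<forall>v\<in>tvertices P. \<forall>i. v $ i = -\<infinity> \<or> (\<exists>m::nat. v $ i = ereal (real m)))"

text \<open>
  The coordinate indices \<open>0, \<dots>, d\<close> are modelled by \<^typ>\<open>'d option\<close>, with \<^const>\<open>None\<close> for the
  additional coordinate \<open>0\<close>. The vertices \<open>v\<^sub>1, \<dots>, v\<^sub>n\<close> index themselves.
\<close>

definition homog :: "ereal^'d \<Rightarrow> 'd option \<Rightarrow> ereal" where
  "homog x i = (case i of None \<Rightarrow> 0 | Some i' \<Rightarrow> x $ i')"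

definition covector_cell :: "('d option \<times> (ereal^'d)) set \<Rightarrow> (ereal^'d) set" where
  "covector_cell G =
     {x \<in> trop_space. \<forall>(i, v)\<in>G. \<forall>k. homog v k + homog x i \<le> homog v i + homog x k}"

definition covector_decomposition :: "(ereal^'d) set \<Rightarrow> (ereal^'d) set set" where
  "covector_decomposition P =
     {covector_cell G | G.
        G \<subseteq> UNIV \<times> tvertices P \<and>
        covector_cell G \<noteq> {} \<and>
        (\<forall>i. \<exists>v. (i, v) \<in> G) \<and>
        (\<forall>v\<in>tvertices P. \<exists>i. (i, v) \<in> G \<and> homog v i \<noteq> -\<infinity>)}"

definition trop_exp :: "real \<Rightarrow> ereal^'d \<Rightarrow> real^'d" where
  "trop_exp b x = (\<chi> i. if x $ i = -\<infinity> then 0 else b powr real_of_ereal (x $ i))"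

text \<open>
  The dimension of a cell is that of its image under \<^term>\<open>trop_exp b\<close>. The base \<open>b > 1\<close> is kept as
  a parameter; the dimension does not depend on it.
\<close>

definition trop_dim :: "real \<Rightarrow> (ereal^'d::finite) set \<Rightarrow> int" where
  "trop_dim b P = Max ((\<lambda>C. aff_dim (trop_exp b ` C)) ` covector_decomposition P)"

definition dilate :: "nat \<Rightarrow> (ereal^'d) set \<Rightarrow> (ereal^'d) set" where
  "dilate k P = (\<lambda>x. \<chi> i. ereal (real k) * x $ i) ` P"

definition int_lattice :: "(ereal^'d) set" where
  "int_lattice = {x. \<forall>i. \<exists>z::int. x $ i = ereal (real_of_int z)}"

end

(*
  If P meets Z^d in a finite nonempty set, no vertex has a coordinate -\<infinity>: from a lattice point x
  and such a vertex w one would obtain the infinitely many lattice points max (x - N, w).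
  So P is a bounded union of sets {x_i - x_k \<le> c, ...} in R^d with integers c (and x_0 = 0),
  and is a finite union of the relatively open faces of the alcoved triangulation of R^d.  Such a face
  is fixed by the integer parts of the coordinates and the order of the fractional parts; if m
  nonzero fractional parts occur, it is an open unimodular simplex whose k-th dilate contains
  (k - 1 choose m) lattice points.  The leading coefficients of these polynomials are positive,
  so the degree of their sum is the largest m.  It is also the largest dimension of a cell of the
  covector decomposition: the image of a face under the exponential map has dimension m, and the
  convex image of a cell, being covered by the affine hulls of finitely many of these, lies
  in one of them.
*)
theory Submission imports Defs begin

section \<open>Tropical convex hulls and their vertices\<close>

lemma ereal_SUP_finite_iff:
  fixes f :: "'a \<Rightarrow> ereal"
  assumes "finite A" "A \<noteq> {}"
  shows "(SUP a\<in>A. f a) = s \<longleftrightarrow> (\<forall>a\<in>A. f a \<le> s) \<and> (\<exists>a\<in>A. f a = s)"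
proof -
  have "(SUP a\<in>A. f a) = Max (f ` A)"
    using assms by (simp add: cSup_eq_Max)
  then show ?thesis
    using assms by (auto simp: Max_eq_iff)
qed

lemma homog_simps [simp]: "homog x None = 0" "homog x (Some i) = x $ i"
  by (simp_all add: homog_def)

lemma homog_neq_PInf: "x \<in> trop_space \<Longrightarrow> homog x i \<noteq> \<infinity>"
  by (cases i) (auto simp: trop_space_def trop_def)

lemma homog_inject: "(\<And>i. homog x i = homog y i) \<Longrightarrow> x = y"
  by (metis homog_simps(2) vec_eq_iff)

text \<open>A finite tropical sum is attained in every coordinate by one of its terms, while all
  terms lie below it. The coordinate \<open>None\<close> carries the normalisation that the largest
  coefficient is 0. Conversely, one attaining term per homogeneous coordinate suffices, the tropical
  form of Caratheodory's theorem.\<close>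

lemma mem_tconv_iff:
  fixes x :: "ereal^'d::finite"
  shows "x \<in> tconv V \<longleftrightarrow>
    (\<forall>i. \<exists>v\<in>V. \<exists>c. (\<forall>k. c + homog v k \<le> homog x k) \<and> c + homog v i = homog x i)"
    (is "_ \<longleftrightarrow> ?R")
proof
  assume "x \<in> tconv V"
  then obtain n and c :: "nat \<Rightarrow> ereal" and v where
    cv: "\<And>j. j \<in> {1..n} \<Longrightarrow> c j \<in> trop \<and> v j \<in> V"
    and sup: "(SUP j\<in>{1..n}. c j) = 0"
    and x: "x = (\<chi> i. SUP j\<in>{1..n}. c j + v j $ i)"
    unfolding tconv_def by blast
  have ne: "{1..n} \<noteq> {}"
  proof
    assume "{1..n} = {}"
    with sup have "(- \<infinity> :: ereal) = 0"
      by (simp only: image_empty Sup_empty bot_ereal_def)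
    then show False
      by simp
  qed
  have xi: "(\<forall>j\<in>{1..n}. c j + homog (v j) i \<le> homog x i) \<and>
      (\<exists>j\<in>{1..n}. c j + homog (v j) i = homog x i)" for i
  proof (cases i)
    case None
    then show ?thesis using sup ereal_SUP_finite_iff[OF _ ne, of c 0] by simp
  next
    case (Some l)
    have "(SUP j\<in>{1..n}. c j + v j $ l) = x $ l"
      by (simp add: x)
    then show ?thesis using ereal_SUP_finite_iff[OF _ ne] Some by simp
  qed
  show ?R
  proof
    fix i
    obtain j where j: "j \<in> {1..n}" "c j + homog (v j) i = homog x i"
      using xi by blast
    then show "\<exists>v\<in>V. \<exists>c. (\<forall>k. c + homog v k \<le> homog x k) \<and> c + homog v i = homog x i"
      using cv xi by (intro bexI[of _ "v j"] exI[of _ "c j"]) auto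
  qed
next
  assume ?R
  then obtain v c where v: "\<And>i. v i \<in> V"
    and le: "\<And>i k. c i + homog (v i) k \<le> homog x k"
    and eq: "\<And>i. c i + homog (v i) i = homog x i"
    by metis
  \<comment> \<open>\<open>tconv\<close> numbers its terms from 1 to n, so the d + 1 coordinates are
    enumerated by \<open>h\<close>.\<close>
  obtain h where h: "bij_betw h {1..CARD('d option)} (UNIV :: 'd option set)"
    using bij_betw_iff_card[of "{1..CARD('d option)}" "UNIV :: 'd option set"] by auto
  have im: "h ` {1..CARD('d option)} = UNIV"
    using h by (simp add: bij_betw_def)
  have ne: "{1..CARD('d option)} \<noteq> {}"
    using im by force
  have ex: "\<exists>j\<in>{1..CARD('d option)}. h j = i" for i
    using im by (metis UNIV_I imageE)
  have SUP: "(SUP j\<in>{1..CARD('d option)}. c (h j) + homog (v (h j)) i) = homog x i" for i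
    unfolding ereal_SUP_finite_iff[OF finite_atLeastAtMost ne] using le eq ex by metis
  have "c i \<le> 0" for i
    using le[of i None] by simp
  then have tr: "c i \<in> trop" for i
    by (metis (mono_tags, lifting) PInfty_neq_ereal(1) ereal_infty_less_eq(1) mem_Collect_eq trop_def zero_ereal_def)
  show "x \<in> tconv V"
    unfolding tconv_def mem_Collect_eq
  proof (intro exI[of _ "CARD('d option)"] exI[of _ "c \<circ> h"] exI[of _ "v \<circ> h"] conjI)
    show "(SUP j\<in>{1..CARD('d option)}. (c \<circ> h) j) = 0"
      using SUP[of None] by simp
    show "x = (\<chi> i. SUP j\<in>{1..CARD('d option)}. (c \<circ> h) j + (v \<circ> h) j $ i)"
      using SUP[of "Some _"] by (simp add: vec_eq_iff)
  qed (use tr v in auto)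
qed

lemma tconv_mono: "V \<subseteq> W \<Longrightarrow> tconv V \<subseteq> tconv (W :: (ereal^'d::finite) set)"
proof
  fix x assume "V \<subseteq> W" "x \<in> tconv V"
  then show "x \<in> tconv W"
    unfolding mem_tconv_iff by (meson subsetD)
qed

lemma subset_tconv: "V \<subseteq> tconv (V :: (ereal^'d::finite) set)"
proof
  fix v assume "v \<in> V"
  then show "v \<in> tconv V"
    unfolding mem_tconv_iff by (intro allI bexI[of _ v] exI[of _ 0]) auto
qed

text \<open>Coefficients multiply tropically: if \<open>w\<close> attains coordinate
  \<open>i\<close> of \<open>x\<close> with coefficient \<open>c\<close>, and \<open>v\<close>
  attains that of \<open>w\<close> with \<open>a\<close>, then \<open>v\<close> attains that of
  \<open>x\<close> with \<open>c + a\<close>.\<close>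

lemma tconv_subset_tconv:
  fixes V W :: "(ereal^'d::finite) set"
  assumes "W \<subseteq> tconv V"
  shows "tconv W \<subseteq> tconv V"
proof
  fix x assume x: "x \<in> tconv W"
  show "x \<in> tconv V"
    unfolding mem_tconv_iff
  proof
    fix i
    obtain w c where w: "w \<in> W" and c: "\<And>k. c + homog w k \<le> homog x k" "c + homog w i = homog x i"
      using x unfolding mem_tconv_iff by meson
    obtain v a where v: "v \<in> V" and a: "\<And>k. a + homog v k \<le> homog w k" "a + homog v i = homog w i"
      using w assms unfolding subset_iff mem_tconv_iff by meson
    have "(c + a) + homog v k \<le> homog x k" for k
      using order_trans[OF add_left_mono[OF a(1)] c(1)] by (simp add: add.assoc)
    moreover have "(c + a) + homog v i = homog x i"
      by (simp add: add.assoc a c)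
    ultimately show "\<exists>v\<in>V. \<exists>c. (\<forall>k. c + homog v k \<le> homog x k) \<and> c + homog v i = homog x i"
      using v by blast
  qed
qed

section \<open>Existence and uniqueness of the vertex set\<close>

text \<open>A generator \<open>v\<close> outside \<open>W\<close> is written through
  \<open>W\<close>, and \<open>W\<close> through \<open>V\<close>. This makes \<open>v\<close> a
  combination of the other elements of \<open>V\<close>, against minimality. Two minimal generating
  sets therefore contain each other.\<close>

lemma minimal_generating_set_subset:
  fixes V W :: "(ereal^'d::finite) set"
  assumes V: "minimal_generating_set P V" and W: "tconv W = P"
  shows "V \<subseteq> W"
proof
  fix v assume v: "v \<in> V"
  show "v \<in> W"
  proof (rule ccontr)
    assume vW: "v \<notin> W"
    have trop: "V \<subseteq> trop_space" and PV: "tconv V = P"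
      using V by (auto simp: minimal_generating_set_def)
    have "v \<in> tconv W" and WP: "W \<subseteq> tconv V"
      using v W PV subset_tconv by blast+
    \<comment> \<open>The multiple of \<open>v\<close> itself among these has coefficient \<open>c < 0\<close>, so it can only attain
      coordinates equal to \<open>-\<infinity>\<close> and is dispensable.\<close>
    have hit: "\<exists>u\<in>V. \<exists>c. c \<le> 0 \<and> (\<forall>k. c + homog u k \<le> homog v k) \<and> c + homog u i = homog v i
        \<and> (u = v \<longrightarrow> c \<noteq> 0)" for i
    proof -
      obtain w c where w: "w \<in> W" and c: "\<And>k. c + homog w k \<le> homog v k" "c + homog w i = homog v i"
        using \<open>v \<in> tconv W\<close> unfolding mem_tconv_iff by meson
      obtain u a where u: "u \<in> V" and a: "\<And>k. a + homog u k \<le> homog w k" "a + homog u i = homog w i"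
        using w WP unfolding subset_iff mem_tconv_iff by meson
      have le: "(c + a) + homog u k \<le> homog v k" for k
        using order_trans[OF add_left_mono[OF a(1)] c(1)] by (simp add: add.assoc)
      have eq: "(c + a) + homog u i = homog v i"
        by (simp add: add.assoc a c)
      have c0: "c \<le> 0" and a0: "a \<le> 0"
        using c(1)[of None] a(1)[of None] by simp_all
      \<comment> \<open>Two nonpositive coefficients with sum 0 both vanish, and then
        \<open>v\<close> and \<open>w\<close> dominate each other.\<close>
      have "c + a \<noteq> 0" if "u = v"
      proof
        assume "c + a = 0"
        then have "c = 0" "a = 0"
          using c0 a0 by (cases c; cases a; auto)+
        then have "homog w k = homog v k" for k
          using a(1)[of k] c(1)[of k] that by (auto intro: antisym)
        then have "w = v"
          by (rule homog_inject)
        then show False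
          using w vW by simp
      qed
      moreover have "c + a \<le> 0"
        using le[of None] by simp
      ultimately show ?thesis
        using u le eq by blast
    qed
    \<comment> \<open>Attaining coordinate \<open>None\<close>, which is 0, takes coefficient 0 and
      hence a generator other than \<open>v\<close>. With coefficient -\<infinity> the same
      \<open>u0\<close> later serves the coordinates where \<open>v\<close> is -\<infinity>.\<close>
    obtain u0 where u0: "u0 \<in> V" "u0 \<noteq> v"
      using hit[of None] by auto
    have "v \<in> tconv (V - {v})"
      unfolding mem_tconv_iff
    proof
      fix i
      obtain u c where u: "u \<in> V" and c: "c \<le> 0" "\<And>k. c + homog u k \<le> homog v k"
          "c + homog u i = homog v i" "u = v \<Longrightarrow> c \<noteq> 0"
        using hit[of i] by blast
      show "\<exists>u\<in>V - {v}. \<exists>c. (\<forall>k. c + homog u k \<le> homog v k) \<and> c + homog u i = homog v i"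
      proof (cases "u = v")
        case False
        then show ?thesis using u c by blast
      next
        case True
        then have "homog v i = - \<infinity>"
          using c homog_neq_PInf[of v i] trop v by (cases c; cases "homog v i") auto
        moreover have u0_inf: "- \<infinity> + homog u0 k = - \<infinity>" for k
          using homog_neq_PInf[of u0 k] trop u0 by (cases "homog u0 k") auto
        ultimately show ?thesis
          using u0 by (intro bexI[of _ u0] exI[of _ "- \<infinity>"]) (simp_all only: u0_inf, auto)
      qed
    qed
    then have "V \<subseteq> tconv (V - {v})"
      using subset_tconv[of "V - {v}"] by auto
    then have "P \<subseteq> tconv (V - {v})"
      using tconv_subset_tconv PV by metis
    moreover have "tconv (V - {v}) \<subseteq> P"
      using tconv_mono[of "V - {v}" V] PV by simp
    moreover have "V - {v} \<subset> V"
      using v by auto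
    ultimately show False
      using V unfolding minimal_generating_set_def by (meson subset_antisym)
  qed
qed

text \<open>Justifies the definite description in \<open>tvertices\<close>: among the finitely many
  generating subsets of \<open>V0\<close> there is an inclusion-minimal one, and it is the only
  minimal generating set.\<close>

lemma tropical_polytope_tvertices:
  fixes P :: "(ereal^'d::finite) set"
  assumes "tropical_polytope P"
  shows "minimal_generating_set P (tvertices P)" "finite (tvertices P)"
proof -
  obtain V0 where V0: "finite V0" "V0 \<subseteq> trop_space" "P = tconv V0"
    using assms by (auto simp: tropical_polytope_def)
  have "finite {V \<in> Pow V0. tconv V = P}" "{V \<in> Pow V0. tconv V = P} \<noteq> {}"
    using V0 by auto
  then obtain V where V: "V \<subseteq> V0" "tconv V = P"
    and min: "\<And>W. W \<subseteq> V0 \<Longrightarrow> tconv W = P \<Longrightarrow> W \<subseteq> V \<Longrightarrow> V = W"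
    using finite_has_minimal[of "{V \<in> Pow V0. tconv V = P}"] by auto
  have mV: "minimal_generating_set P V"
    unfolding minimal_generating_set_def using V V0 min by blast
  have "tvertices P = V"
    unfolding tvertices_def
  proof (rule the_equality)
    show "minimal_generating_set P V"
      by (rule mV)
    fix W assume "minimal_generating_set P W"
    then show "W = V"
      using mV minimal_generating_set_subset by (metis minimal_generating_set_def subset_antisym)
  qed
  then show "minimal_generating_set P (tvertices P)" "finite (tvertices P)"
    using mV V V0 finite_subset by auto
qed

section \<open>Lattice points force finite vertex coordinates\<close>

lemma tvertices_finite_coords:
  fixes P :: "(ereal^'d::finite) set"
  assumes can: "canonical_tropical_lattice_polytope P"
    and fin: "finite (P \<inter> int_lattice)" and ne: "P \<inter> int_lattice \<noteq> {}"
    and w: "w \<in> tvertices P"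
  shows "\<exists>m::int. w $ i = ereal (real_of_int m)"
proof (rule ccontr)
  assume no: "\<not> (\<exists>m::int. w $ i = ereal (real_of_int m))"
  have coords: "v $ l = - \<infinity> \<or> (\<exists>m::int. v $ l = ereal (real_of_int m))" if "v \<in> tvertices P" for v l
    using can that unfolding canonical_tropical_lattice_polytope_def by (metis of_int_of_nat_eq)
  define V where "V = tvertices P"
  have V: "tvertices P = V"
    by (simp add: V_def)
  have "tropical_polytope P"
    using can by (simp add: canonical_tropical_lattice_polytope_def)
  then have "tconv (tvertices P) = P"
    using tropical_polytope_tvertices(1) minimal_generating_set_def by blast
  then have PV: "P = tconv V"
    by (simp only: V_def)
  have wi: "w $ i = - \<infinity>"
    using coords[OF w] no by blast
  obtain x where xP: "x \<in> P" and x: "x \<in> int_lattice"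
    using ne by blast
  then obtain z where z: "\<And>l. x $ l = ereal (real_of_int (z l))"
    unfolding int_lattice_def by (auto dest: choice)
  \<comment> \<open>The tropical combination of \<open>x\<close> with coefficient -N and
    \<open>w\<close> with coefficient 0; the latter keeps coordinate \<open>None\<close> at
    0.\<close>
  define y where "y N = (\<chi> l. max (ereal (- real N) + x $ l) (w $ l))" for N :: nat
  have hy: "homog (y N) l = max (ereal (- real N) + homog x l) (homog w l)" for N l
    by (cases l) (auto simp: y_def max_def zero_ereal_def)
  have w_le: "homog w l \<le> homog (y N) l" and x_le: "ereal (- real N) + homog x l \<le> homog (y N) l" for N l
    unfolding hy by (rule max.cobounded2, rule max.cobounded1)
  have "y N \<in> P" for N
    unfolding PV mem_tconv_iff
  proof
    fix l
    show "\<exists>v\<in>V. \<exists>c. (\<forall>k. c + homog v k \<le> homog (y N) k) \<and> c + homog v l = homog (y N) l"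
    proof (cases "homog (y N) l = homog w l")
      case True
      then show ?thesis
        using w V w_le by (metis add_0)
    next
      case False
      then have l: "homog (y N) l = ereal (- real N) + homog x l"
        unfolding hy by (metis max_def)
      obtain v c where v: "v \<in> V" and c: "\<And>k. c + homog v k \<le> homog x k"
          "c + homog v l = homog x l"
        using xP unfolding PV mem_tconv_iff by meson
      have "(ereal (- real N) + c) + homog v k \<le> homog (y N) k" for k
        using order_trans[OF add_left_mono[OF c(1)] x_le] by (simp only: add.assoc)
      moreover have "(ereal (- real N) + c) + homog v l = homog (y N) l"
        by (simp only: add.assoc c l)
      ultimately show ?thesis
        using v by blast
    qed
  qed
  moreover have "y N \<in> int_lattice" for N
    unfolding int_lattice_def
  proof safe
    fix l
    show "\<exists>m::int. y N $ l = ereal (real_of_int m)"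
    proof (cases "w $ l = - \<infinity>")
      case True
      then show ?thesis
        by (intro exI[of _ "z l - int N"]) (simp add: y_def z)
    next
      case False
      then obtain m :: int where "w $ l = ereal (real_of_int m)"
        using coords[OF w] by blast
      then show ?thesis
        by (intro exI[of _ "max (z l - int N) m"]) (auto simp: y_def z max_def)
    qed
  qed
  \<comment> \<open>In coordinate \<open>i\<close>, where \<open>w\<close> is -\<infinity>, the
    point \<open>y N\<close> has the entry x_i - N.\<close>
  moreover have "inj y"
  proof
    fix M N assume "y M = y N"
    then have "y M $ i = y N $ i"
      by simp
    then show "M = N"
      by (simp add: y_def wi z max_def split: if_splits)
  qed
  ultimately have "infinite (P \<inter> int_lattice)"
    by (meson IntI finite_subset image_subsetI infinite_UNIV_nat finite_imageD)
  with fin show False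
    by simp
qed

section \<open>Alcoves\<close>

text \<open>Ranks keep the order of the elements of a finite set and forget their values.\<close>

definition rank_in :: "'a::linorder set \<Rightarrow> 'a \<Rightarrow> nat" where
  "rank_in A a = card {s \<in> A. s < a}"

lemma rank_in_less_iff:
  assumes "finite A" "a \<in> A" "b \<in> A"
  shows "rank_in A a < rank_in A b \<longleftrightarrow> a < b"
proof -
  have "rank_in A a < rank_in A b" if "a < b" "a \<in> A" for a b
    unfolding rank_in_def using that assms(1) by (intro psubset_card_mono) auto
  then show ?thesis
    using assms by (metis less_asym linorder_neqE)
qed

lemma rank_in_eq_iff:
  assumes "finite A" "a \<in> A" "b \<in> A"
  shows "rank_in A a = rank_in A b \<longleftrightarrow> a = b"
  by (metis assms rank_in_less_iff linorder_neqE less_irrefl)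

lemma rank_in_image:
  assumes "finite A"
  shows "rank_in A ` A = {..<card A}"
proof (rule card_subset_eq)
  show "rank_in A ` A \<subseteq> {..<card A}"
    unfolding rank_in_def using assms by (auto intro!: psubset_card_mono)
  have "inj_on (rank_in A) A"
    using assms by (auto simp: inj_on_def rank_in_eq_iff)
  then show "card (rank_in A ` A) = card {..<card A}"
    by (simp add: card_image)
qed simp

lemma rank_in_strict_mono_image:
  assumes "strict_mono_on A g" "a \<in> A"
  shows "rank_in (g ` A) (g a) = rank_in A a"
proof -
  have "{s \<in> g ` A. s < g a} = g ` {s \<in> A. s < a}"
    using assms by (auto simp: strict_mono_on_less)
  moreover have "inj_on g {s \<in> A. s < a}"
    using strict_mono_on_imp_inj_on[OF assms(1)] by (rule inj_on_subset) auto
  ultimately show ?thesis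
    by (simp add: rank_in_def card_image)
qed

definition rhomog :: "real^'d \<Rightarrow> 'd option \<Rightarrow> real" where
  "rhomog x i = (case i of None \<Rightarrow> 0 | Some l \<Rightarrow> x $ l)"

lemma rhomog_simps [simp]: "rhomog x None = 0" "rhomog x (Some i) = x $ i"
  by (simp_all add: rhomog_def)

definition fracs :: "real^'d \<Rightarrow> real set" where
  "fracs x = range (\<lambda>i. frac (rhomog x i))"

text \<open>
  The coordinate \<open>x\<^sub>0 = 0\<close> contributes the fractional part \<open>0\<close>, so rank \<open>0\<close> marks the integer
  coordinates and the dimension of an alcove is its number of ranks minus one.
\<close>
definition frac_rank :: "real^'d \<Rightarrow> 'd option \<Rightarrow> nat" where
  "frac_rank x i = rank_in (fracs x) (frac (rhomog x i))"

text \<open>A label for the relatively open face containing \<open>x\<close> in the subdivision by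
  all hyperplanes x_i - x_k = n with n an integer and x_0 = 0. Two points share a label exactly if
  they lie in the same face.\<close>

definition alcove :: "real^'d \<Rightarrow> ('d option \<Rightarrow> int) \<times> ('d option \<Rightarrow> nat)" where
  "alcove x = (\<lambda>i. \<lfloor>rhomog x i\<rfloor>, frac_rank x)"

definition alcove_dim :: "('d option \<Rightarrow> int) \<times> ('d option \<Rightarrow> nat) \<Rightarrow> nat" where
  "alcove_dim c = card (range (snd c)) - 1"

lemma finite_fracs [simp]: "finite (fracs (x :: real^'d::finite))"
  by (simp add: fracs_def)

lemma frac_in_fracs [simp]: "frac (rhomog x i) \<in> fracs x"
  by (simp add: fracs_def)

lemma zero_in_fracs [simp]: "0 \<in> fracs x"
  unfolding fracs_def by (rule range_eqI[of _ _ None]) simp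

lemma frac_rank_None [simp]: "frac_rank x None = 0"
  by (auto simp: frac_rank_def rank_in_def fracs_def simp flip: not_le)

lemma range_frac_rank: "range (frac_rank x) = {..<card (fracs (x :: real^'d::finite))}"
proof -
  have "range (frac_rank x) = rank_in (fracs x) ` fracs x"
    by (auto simp: frac_rank_def fracs_def)
  then show ?thesis
    by (simp add: rank_in_image)
qed

lemma card_fracs: "card (fracs (x :: real^'d::finite)) = Suc (alcove_dim (alcove x))"
proof -
  have "card (fracs x) > 0"
    using zero_in_fracs[of x] by (auto simp: card_gt_0_iff simp del: zero_in_fracs)
  then show ?thesis
    by (simp add: alcove_dim_def alcove_def range_frac_rank)
qed

lemma range_frac_rank': "range (frac_rank x) = {..alcove_dim (alcove (x :: real^'d::finite))}"
  by (simp add: range_frac_rank card_fracs lessThan_Suc_atMost)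

text \<open>Fractional parts differ by less than 1, so they matter only when the integer parts
  differ by exactly \<open>n\<close>.\<close>

lemma diff_le_of_int_iff:
  fixes x y :: real
  shows "x - y \<le> of_int n \<longleftrightarrow> \<lfloor>x\<rfloor> - \<lfloor>y\<rfloor> < n \<or> \<lfloor>x\<rfloor> - \<lfloor>y\<rfloor> = n \<and> frac x \<le> frac y"
proof -
  have eq: "x - y = of_int (\<lfloor>x\<rfloor> - \<lfloor>y\<rfloor>) + (frac x - frac y)"
    by (simp add: frac_def)
  have "\<bar>frac x - frac y\<bar> < 1"
    using frac_ge_0[of x] frac_lt_1[of x] frac_ge_0[of y] frac_lt_1[of y] by linarith
  note fr = this
  consider "of_int (\<lfloor>x\<rfloor> - \<lfloor>y\<rfloor>) \<le> real_of_int (n - 1)" "\<lfloor>x\<rfloor> - \<lfloor>y\<rfloor> < n"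
    | "\<lfloor>x\<rfloor> - \<lfloor>y\<rfloor> = n"
    | "of_int (\<lfloor>x\<rfloor> - \<lfloor>y\<rfloor>) \<ge> real_of_int (n + 1)" "\<lfloor>x\<rfloor> - \<lfloor>y\<rfloor> > n"
    unfolding of_int_le_iff by linarith
  then show ?thesis
  proof cases
    case 1
    then show ?thesis using fr eq by auto
  next
    case 2
    then show ?thesis using fr eq by auto
  next
    case 3
    then show ?thesis using fr eq by auto
  qed
qed

text \<open>Such an inequality depends only on integer parts and on the order of two fractional
  parts, both of which the label records.\<close>

lemma alcove_eq_diff_le_iff:
  fixes x y :: "real^'d::finite"
  assumes "alcove x = alcove y"
  shows "rhomog x i - rhomog x k \<le> of_int n \<longleftrightarrow> rhomog y i - rhomog y k \<le> of_int n"
proof -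
  have r: "frac (rhomog x i) \<le> frac (rhomog x k) \<longleftrightarrow> frac_rank x i \<le> frac_rank x k" for x :: "real^'d"
    unfolding frac_rank_def using rank_in_less_iff[of "fracs x"] by (simp flip: not_less)
  have "\<lfloor>rhomog x i\<rfloor> = \<lfloor>rhomog y i\<rfloor>" "\<lfloor>rhomog x k\<rfloor> = \<lfloor>rhomog y k\<rfloor>" "frac_rank x = frac_rank y"
    using assms by (auto simp: alcove_def fun_eq_iff)
  then show ?thesis
    unfolding diff_le_of_int_iff r by simp
qed

text \<open>Builds points of a given alcove: any increasing chain of values in [0,1) may replace the
  fractional parts, since a monotone change keeps the ranks. At \<open>None\<close> the equation for
  \<open>y\<close> forces \<open>g 0 = 0\<close>.\<close>

lemma alcove_eqI:
  fixes x y :: "real^'d::finite"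
  assumes y: "\<And>i. rhomog y i = of_int \<lfloor>rhomog x i\<rfloor> + g (frac_rank x i)"
    and mono: "strict_mono_on {..alcove_dim (alcove x)} g"
    and g: "\<And>j. j \<le> alcove_dim (alcove x) \<Longrightarrow> 0 \<le> g j \<and> g j < 1"
  shows "alcove y = alcove x" "fracs y = g ` {..alcove_dim (alcove x)}"
proof -
  have le: "frac_rank x i \<le> alcove_dim (alcove x)" for i
    using range_frac_rank'[of x] by auto
  have fl: "\<lfloor>rhomog y i\<rfloor> = \<lfloor>rhomog x i\<rfloor>" for i
    using y[of i] g[OF le[of i]] by (simp add: floor_unique)
  have fr: "frac (rhomog y i) = g (frac_rank x i)" for i
    using y[of i] fl[of i] by (simp add: frac_def)
  show fracs_y: "fracs y = g ` {..alcove_dim (alcove x)}"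
    unfolding fracs_def fr range_frac_rank'[symmetric] by (simp add: image_image)
  have "frac_rank y i = frac_rank x i" for i
  proof -
    have "frac_rank y i = rank_in {..alcove_dim (alcove x)} (frac_rank x i)"
      using rank_in_strict_mono_image[OF mono, of "frac_rank x i"] le
      by (simp add: frac_rank_def[of y] fr fracs_y)
    also have "\<dots> = card {..<frac_rank x i}"
      unfolding rank_in_def using le[of i] by (intro arg_cong[where f = card]) auto
    finally show ?thesis
      by simp
  qed
  then show "alcove y = alcove x"
    by (simp add: alcove_def fl fun_eq_iff)
qed

text \<open>Ranks are injective on the set of fractional parts, so this set together with the label
  recovers every coordinate.\<close>

lemma alcove_frac_eqI:
  fixes x y :: "real^'d::finite"
  assumes "alcove x = alcove y" "fracs x = fracs y"
  shows "x = y"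
proof -
  have "x $ i = y $ i" for i
  proof -
    have "frac_rank x (Some i) = frac_rank y (Some i)" "\<lfloor>x $ i\<rfloor> = \<lfloor>y $ i\<rfloor>"
      using assms(1) by (auto simp: alcove_def dest: fun_cong[of _ _ "Some i"])
    moreover from this have "frac (rhomog x (Some i)) = frac (rhomog y (Some i))"
      using assms(2) frac_in_fracs[of y "Some i"] frac_in_fracs[of x "Some i"]
      by (metis finite_fracs frac_rank_def rank_in_eq_iff)
    ultimately show ?thesis
      by (simp add: frac_def)
  qed
  then show ?thesis
    by (simp add: vec_eq_iff)
qed

section \<open>Lattice points in dilated alcoves\<close>

text \<open>A point of \<open>L\<close> is determined by its nonzero fractional parts. These form an
  arbitrary set of \<open>alcove_dim (alcove x)\<close> elements among 1/k, ..., (k-1)/k.\<close>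

lemma card_alcove_lattice_points:
  fixes x :: "real^'d::finite"
  assumes k: "k > 0"
  defines "L \<equiv> {y. alcove y = alcove x \<and> (\<forall>i. real k * y $ i \<in> \<int>)}"
  shows "finite L" "card L = (k - 1) choose alcove_dim (alcove x)"
proof -
  define m where "m = alcove_dim (alcove x)"
  define Q where "Q = (\<lambda>j. real j / real k) ` {1..<k}"
  have finQ: "finite Q"
    by (simp add: Q_def)
  have cardQ: "card Q = k - 1"
    unfolding Q_def using k by (subst card_image) (auto simp: inj_on_def)
  have Q0: "0 \<notin> Q" and Q1: "\<And>q. q \<in> Q \<Longrightarrow> 0 \<le> q \<and> q < 1" and QI: "\<And>q. q \<in> Q \<Longrightarrow> real k * q \<in> \<int>"
    using k by (auto simp: Q_def)
  have "bij_betw (\<lambda>y. fracs y - {0}) L {B. B \<subseteq> Q \<and> card B = m}"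
    unfolding bij_betw_def
  proof
    show "inj_on (\<lambda>y. fracs y - {0}) L"
    proof (rule inj_onI)
      fix y y' assume "y \<in> L" "y' \<in> L" "fracs y - {0} = fracs y' - {0}"
      then show "y = y'"
        using zero_in_fracs[of y] zero_in_fracs[of y']
        by (intro alcove_frac_eqI) (auto simp: L_def)
    qed
    show "(\<lambda>y. fracs y - {0}) ` L = {B. B \<subseteq> Q \<and> card B = m}"
    proof (intro equalityI subsetI)
      fix B assume "B \<in> (\<lambda>y. fracs y - {0}) ` L"
      then obtain y where y: "y \<in> L" "B = fracs y - {0}"
        by blast
      have "card B = m"
        using y by (simp add: card_fracs L_def m_def)
      moreover have "B \<subseteq> Q"
      proof
        fix s assume "s \<in> B"
        then obtain i where s: "s = frac (rhomog y i)" "s \<noteq> 0"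
          using y by (auto simp: fracs_def)
        have "real k * rhomog y i \<in> \<int>"
          using y(1) by (cases i) (auto simp: L_def)
        moreover have "real k * s = real k * rhomog y i - of_int (int k * \<lfloor>rhomog y i\<rfloor>)"
          by (simp add: s frac_def algebra_simps)
        ultimately have "real k * s \<in> \<int>"
          by (metis Ints_diff Ints_of_int)
        then obtain n where n: "real k * s = of_int n"
          by (auto elim: Ints_cases)
        have "0 < s" "s < 1"
          using s frac_ge_0[of "rhomog y i"] frac_lt_1[of "rhomog y i"] by linarith+
        then have "0 < real k * s" "real k * s < real k"
          using k by simp_all
        then have "0 < n" "n < int k"
          unfolding n by linarith+
        then have "nat n \<in> {1..<k}"
          by auto
        moreover have "s = real (nat n) / real k"
          using n k \<open>0 < n\<close> by (simp add: field_simps)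
        ultimately show "s \<in> Q"
          unfolding Q_def by blast
      qed
      ultimately show "B \<in> {B. B \<subseteq> Q \<and> card B = m}"
        by blast
    next
      fix B assume "B \<in> {B. B \<subseteq> Q \<and> card B = m}"
      then have B: "B \<subseteq> Q" "card B = m" "finite B" "0 \<notin> B"
        using finQ finite_subset Q0 by auto
      \<comment> \<open>For surjectivity, the value 0 contributed by \<open>None\<close> is put
        back, and \<open>g\<close> below lists the resulting set in increasing order.\<close>
      define A where "A = insert 0 B"
      have A: "finite A" "card A = Suc m"
        using B by (auto simp: A_def)
      have A01: "a \<in> A \<Longrightarrow> 0 \<le> a \<and> a < 1 \<and> real k * a \<in> \<int>" for a
        using Q1 QI B by (auto simp: A_def)
      have im: "rank_in A ` A = {..m}"
        using rank_in_image[of A] A by (simp add: lessThan_Suc_atMost)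
      define g where "g = inv_into A (rank_in A)"
      have gA: "g j \<in> A" and rg: "rank_in A (g j) = j" if "j \<le> m" for j
        using that im by (auto simp: g_def inv_into_into f_inv_into_f)
      have gr: "g (rank_in A a) = a" if "a \<in> A" for a
        using that A by (auto simp: g_def inj_on_def rank_in_eq_iff intro!: inv_into_f_f)
      have mono: "strict_mono_on {..m} g"
        using gA rg A by (auto simp: strict_mono_on_def simp flip: rank_in_less_iff[OF A(1)])
      \<comment> \<open>0 is the least element of \<open>A\<close>, so \<open>g 0 = 0\<close>, as
        coordinate \<open>None\<close> requires.\<close>
      have "rank_in A 0 = 0"
        using A01 A(1) by (force simp: rank_in_def)
      then have g0: "g 0 = 0"
        using gr[of 0] by (simp add: A_def)
      define y where "y = (\<chi> i. of_int \<lfloor>rhomog x (Some i)\<rfloor> + g (frac_rank x (Some i)))"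
      have y: "rhomog y i = of_int \<lfloor>rhomog x i\<rfloor> + g (frac_rank x i)" for i
        by (cases i) (simp_all add: y_def g0)
      have le: "frac_rank x i \<le> m" for i
        using range_frac_rank'[of x] by (auto simp: m_def)
      have alc: "alcove y = alcove x" and fr: "fracs y = g ` {..m}"
        using alcove_eqI[OF y] mono gA A01 by (auto simp: m_def)
      have "g ` {..m} = A"
        using gA gr im by (auto simp: image_iff) (metis atMost_iff gr image_eqI)
      then have "B = fracs y - {0}"
        using fr B by (auto simp: A_def)
      moreover have "real k * y $ i \<in> \<int>" for i
      proof -
        have "real k * y $ i = of_int (int k * \<lfloor>x $ i\<rfloor>) + real k * g (frac_rank x (Some i))"
          by (simp add: y_def algebra_simps)
        then show ?thesis
          using A01[OF gA[OF le]] by (metis Ints_add Ints_of_int)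
      qed
      ultimately show "B \<in> (\<lambda>y. fracs y - {0}) ` L"
        using alc by (auto simp: L_def)
    qed
  qed
  moreover have "finite {B. B \<subseteq> Q \<and> card B = m}" "card {B. B \<subseteq> Q \<and> card B = m} = (k - 1) choose m"
    using finQ n_subsets[OF finQ, of m] cardQ by auto
  ultimately show "finite L" "card L = (k - 1) choose alcove_dim (alcove x)"
    unfolding m_def[symmetric] by (auto simp: bij_betw_finite dest: bij_betw_same_card)
qed

section \<open>The dimension of an alcove under the exponential map\<close>

text \<open>If \<open>p\<close> avoids one affine set and \<open>q\<close> avoids all the others,
  the line through them lies in none of the sets. It meets each in at most one point, yet the
  segment between them is infinite and covered.\<close>

lemma convex_subset_finite_affine_cover:
  fixes C :: "'a::real_vector set"
  assumes "finite I" "convex C" "C \<noteq> {}" "\<And>i. i \<in> I \<Longrightarrow> affine (A i)" "C \<subseteq> (\<Union>i\<in>I. A i)"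
  shows "\<exists>i\<in>I. C \<subseteq> A i"
  using assms(1,4,5)
proof (induction I)
  case empty
  then show ?case using assms(3) by simp
next
  case (insert i I)
  show ?case
  proof (rule ccontr)
    assume no: "\<not> ?case"
    then obtain p where p: "p \<in> C" "p \<notin> A i"
      by auto
    have "\<not> C \<subseteq> (\<Union>i\<in>I. A i)"
      using no insert by auto
    then obtain q where q: "q \<in> C" "\<And>j. j \<in> I \<Longrightarrow> q \<notin> A j"
      by blast
    define f where "f u = (1 - u) *\<^sub>R p + u *\<^sub>R q" for u :: real
    have line: "f w \<in> A j" if "j \<in> insert i I" "f u \<in> A j" "f u' \<in> A j" "u \<noteq> u'" for j u u' w
    proof -
      define t where "t = (w - u) / (u' - u)"
      have t: "(1 - t) * u + t * u' = w"
        using that(4) unfolding t_def by (simp add: divide_simps) (simp add: algebra_simps)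
      have "f w = (1 - t) *\<^sub>R f u + t *\<^sub>R f u'"
        unfolding f_def t[symmetric] by (simp add: algebra_simps)
      also have "\<dots> \<in> A j"
        using insert.prems(1)[OF that(1)] that(2,3) by (simp add: mem_affine)
      finally show ?thesis .
    qed
    have "finite {u. f u \<in> A j}" if j: "j \<in> insert i I" for j
    proof -
      \<comment> \<open>\<open>f 0 = p\<close> misses the set of index \<open>i\<close>, and
        \<open>f 1 = q\<close> misses the rest.\<close>
      have "f 0 \<notin> A j \<or> f 1 \<notin> A j"
        using p q j by (auto simp: f_def)
      then have "\<And>u u'. f u \<in> A j \<Longrightarrow> f u' \<in> A j \<Longrightarrow> u = u'"
        using line[OF j] by blast
      then have "{u. f u \<in> A j} \<subseteq> {u}" if "f u \<in> A j" for u
        using that by blast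
      then show ?thesis
        by (metis (mono_tags, lifting) empty_Collect_eq finite.emptyI finite.insertI finite_subset)
    qed
    then have "finite (\<Union>j\<in>insert i I. {u. f u \<in> A j})"
      using insert.hyps by blast
    moreover have "{0..1} \<subseteq> (\<Union>j\<in>insert i I. {u. f u \<in> A j})"
    proof
      fix u :: real assume "u \<in> {0..1}"
      then have "f u \<in> C"
        using convexD_alt[OF assms(2) p(1) q(1), of u] by (simp add: f_def)
      then show "u \<in> (\<Union>j\<in>insert i I. {u. f u \<in> A j})"
        using insert.prems(2) by auto
    qed
    ultimately have "finite {0..1::real}"
      by (rule rev_finite_subset)
    then show False
      using infinite_Icc[of "0::real" 1] by simp
  qed
qed

definition texp :: "real \<Rightarrow> real^'d \<Rightarrow> real^'d" where
  "texp b x = (\<chi> i. b powr (x $ i))"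

text \<open>Integer parts become fixed factors \<open>a i\<close>, and the fractional part of rank
  \<open>j\<close> becomes a number \<open>s j\<close>. The image thus consists of the points
  \<open>L s\<close> over all chains 1 = s 0 < s 1 < ... < s m < b. These strict inequalities are
  open conditions on m free parameters, on which \<open>L\<close> is injective.\<close>

lemma aff_dim_texp_alcove:
  fixes x :: "real^'d::finite"
  assumes b: "b > 1"
  shows "aff_dim (texp b ` {y. alcove y = alcove x}) = int (alcove_dim (alcove x))"
proof -
  define F where "F = {y. alcove y = alcove x}"
  define m where "m = alcove_dim (alcove x)"
  define r where "r i = frac_rank x (Some i)" for i
  define a where "a i = b powr of_int \<lfloor>x $ i\<rfloor>" for i
  define L where "L s = (\<chi> i. a i * s (r i))" for s :: "nat \<Rightarrow> real"
  \<comment> \<open>\<open>e j\<close> is supported on the coordinates of rank \<open>j\<close>, so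
    distinct ones are orthogonal.\<close>
  define e where "e j = L (\<lambda>l. of_bool (l = j))" for j
  have a: "a i > 0" for i
    using b by (simp add: a_def)
  have r_le: "r i \<le> m" for i
    using range_frac_rank'[of x] by (auto simp: m_def r_def)
  \<comment> \<open>A positive rank is attained by a proper coordinate because \<open>None\<close>
    has rank 0. Hence \<open>e j\<close> is nonzero for j >= 1, while \<open>e 0\<close> may
    vanish.\<close>
  have r_ex: "\<exists>i. r i = j" if "1 \<le> j" "j \<le> m" for j
  proof -
    have "j \<in> range (frac_rank x)"
      using that by (simp add: range_frac_rank' m_def)
    then obtain i where i: "j = frac_rank x i"
      by blast
    then show ?thesis
      using that by (cases i) (auto simp: r_def)
  qed
  have L_sum: "L s = s 0 *\<^sub>R e 0 + (\<Sum>j\<in>{1..m}. s j *\<^sub>R e j)" for s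
  proof -
    have "L s $ i = (\<Sum>j\<in>{..m}. s j *\<^sub>R e j) $ i" for i
      using r_le[of i] by (simp add: L_def e_def of_bool_def if_distrib if_distribR cong: if_cong)
    moreover have "{..m} = insert 0 {1..m}"
      by auto
    ultimately show ?thesis
      by (simp add: vec_eq_iff)
  qed
  have e_neq: "e j \<noteq> 0" if j: "j \<in> {1..m}" for j
  proof -
    obtain i where "r i = j"
      using r_ex[of j] j by auto
    then have "e j $ i \<noteq> 0"
      using a[of i] by (simp add: e_def L_def)
    then show ?thesis
      by auto
  qed
  have e_orth: "e j \<bullet> e l = 0" if "j \<noteq> l" for j l
    using that by (auto simp: inner_vec_def e_def L_def intro!: sum.neutral)
  have inj: "inj_on e {1..m}"
    using e_neq e_orth by (metis inj_onI inner_eq_zero_iff)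
  have "pairwise orthogonal (e ` {1..m})"
    unfolding pairwise_def orthogonal_def using e_orth by (metis imageE)
  moreover have "0 \<notin> e ` {1..m}"
    using e_neq by force
  ultimately have "independent (e ` {1..m})"
    by (rule pairwise_orthogonal_independent)
  then have dim: "dim (span (e ` {1..m})) = m"
    using inj by (simp add: dim_eq_card_independent card_image)
  \<comment> \<open>The prospective affine hull of the image.\<close>
  define A where "A = (+) (e 0) ` span (e ` {1..m})"
  have A: "A = {L s | s. s 0 = 1}"
  proof (intro equalityI subsetI)
    fix y assume "y \<in> A"
    then obtain u where u: "y = e 0 + (\<Sum>v\<in>e ` {1..m}. u v *\<^sub>R v)"
      by (auto simp: A_def span_finite)
    define s where "s j = (if j = 0 then 1 else u (e j))" for j :: nat
    have "y = L s"
      unfolding L_sum u sum.reindex[OF inj] by (simp add: s_def)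
    then show "y \<in> {L s | s. s 0 = 1}"
      by (auto simp: s_def)
  next
    fix y assume "y \<in> {L s | s. s 0 = 1}"
    then obtain s where s: "y = L s" "s 0 = 1"
      by auto
    have "(\<Sum>j\<in>{1..m}. s j *\<^sub>R e j) \<in> span (e ` {1..m})"
      by (intro span_sum span_scale span_base) auto
    then show "y \<in> A"
      unfolding A_def s L_sum by (auto simp: s)
  qed
  have A_dim: "aff_dim A = int m"
    unfolding A_def using dim by (simp add: aff_dim_translation_eq aff_dim_subspace)
  have texp_eq: "\<exists>s. texp b y = L s \<and> s 0 = 1 \<and> strict_mono_on {..m} s \<and> (\<forall>j\<le>m. s j < b)"
    if "y \<in> F" for y
  proof -
    have al: "alcove y = alcove x"
      using that by (simp add: F_def)
    then have fl: "\<lfloor>y $ i\<rfloor> = \<lfloor>x $ i\<rfloor>" and rk: "frac_rank y i' = frac_rank x i'" for i i'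
      by (auto simp: alcove_def dest: fun_cong[of _ _ "Some i"])
    have "\<exists>i. frac_rank y i = j" if "j \<le> m" for j
    proof -
      have "j \<in> range (frac_rank y)"
        using that by (simp add: range_frac_rank' m_def al)
      then show ?thesis
        by blast
    qed
    then obtain h where h: "\<And>j. j \<le> m \<Longrightarrow> frac_rank y (h j) = j"
      by metis
    have eq: "frac (rhomog y i) = frac (rhomog y k)" if "frac_rank y i = frac_rank y k" for i k
      using that by (simp add: frac_rank_def rank_in_eq_iff)
    define s where "s j = b powr frac (rhomog y (h j))" for j
    have "texp b y $ i = L s $ i" for i
    proof -
      have "frac (rhomog y (h (r i))) = frac (rhomog y (Some i))"
        using h[OF r_le[of i]] by (intro eq) (simp add: rk r_def)
      then have "y $ i = of_int \<lfloor>x $ i\<rfloor> + frac (rhomog y (h (r i)))"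
        by (simp add: frac_def fl)
      then show ?thesis
        by (simp add: texp_def L_def a_def s_def powr_add)
    qed
    moreover have "s 0 = 1"
      using eq[of "h 0" None] h[of 0] b by (simp add: s_def)
    moreover have "strict_mono_on {..m} s"
    proof (rule strict_mono_onI)
      fix j l assume jl: "j \<in> {..m}" "l \<in> {..m}" "j < l"
      then have "frac_rank y (h j) < frac_rank y (h l)"
        by (simp add: h)
      then have "frac (rhomog y (h j)) < frac (rhomog y (h l))"
        by (simp add: frac_rank_def rank_in_less_iff)
      then show "s j < s l"
        using b by (simp add: s_def)
    qed
    moreover have "s j < b" for j
      using b powr_less_mono[of "frac (rhomog y (h j))" 1 b] by (simp add: s_def frac_lt_1)
    ultimately show ?thesis
      by (auto simp: vec_eq_iff)
  qed
  \<comment> \<open>Logarithms to base \<open>b\<close> turn such a chain into admissible fractional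
    parts in [0,1).\<close>
  have mem_F: "L s \<in> texp b ` F" if s: "s 0 = 1" "strict_mono_on {..m} s" "\<forall>j\<le>m. s j < b" for s
  proof -
    have s1: "1 \<le> s j" if "j \<le> m" for j
      using s(1) strict_mono_onD[OF s(2), of 0 j] that by (cases "j = 0") auto
    define g where "g j = log b (s j)" for j
    have g0: "g 0 = 0"
      using s by (simp add: g_def)
    define y where "y = (\<chi> i. of_int \<lfloor>x $ i\<rfloor> + g (r i))"
    have y: "rhomog y i = of_int \<lfloor>rhomog x i\<rfloor> + g (frac_rank x i)" for i
      by (cases i) (simp_all add: y_def r_def g0)
    have "strict_mono_on {..m} g"
    proof (rule strict_mono_onI)
      fix j l assume jl: "j \<in> {..m}" "l \<in> {..m}" "j < l"
      then have "s j < s l"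
        using s(2) by (simp add: strict_mono_on_def)
      then show "g j < g l"
        using s1[of j] jl b by (simp add: g_def)
    qed
    moreover have "0 \<le> g j \<and> g j < 1" if "j \<le> m" for j
    proof -
      have "log b 1 \<le> log b (s j)" "log b (s j) < log b b"
        using s1[OF that] s(3) that b by (subst log_le_cancel_iff log_less_cancel_iff; force)+
      then show ?thesis
        using b by (simp add: g_def)
    qed
    ultimately have "y \<in> F"
      unfolding F_def using alcove_eqI(1)[OF y] by (simp add: m_def)
    moreover have "texp b y = L s"
      using s1[OF r_le] b by (simp add: vec_eq_iff texp_def L_def y_def powr_add a_def g_def less_le_trans[OF zero_less_one])
    ultimately show ?thesis
      by (metis imageI)
  qed
  have "texp b ` F \<subseteq> A"
    unfolding A using texp_eq by blast
  then have le: "aff_dim (texp b ` F) \<le> int m"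
    using aff_dim_subset A_dim by metis
  obtain s0 where s0: "texp b x = L s0" "s0 0 = 1" "strict_mono_on {..m} s0" "\<forall>j\<le>m. s0 j < b"
    using texp_eq[of x] by (auto simp: F_def)
  have "A \<subseteq> affine hull (texp b ` F)"
  proof
    fix y assume "y \<in> A"
    then obtain s where s: "y = L s" "s 0 = 1"
      unfolding A by blast
    \<comment> \<open>Moving from the chain \<open>s0\<close> of \<open>x\<close> towards
      \<open>s\<close> by a small \<epsilon> keeps all strict inequalities. So \<open>y\<close> lies
      on a line through two points of the image.\<close>
    define p where "p \<epsilon> j = s0 j + \<epsilon> * (s j - s0 j)" for \<epsilon> j
    have lim: "((\<lambda>\<epsilon>. p \<epsilon> j) \<longlongrightarrow> s0 j) (at_right 0)" for j
      unfolding p_def by (auto intro!: tendsto_eq_intros)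
    have "\<forall>\<^sub>F \<epsilon> in at_right 0. p \<epsilon> j < p \<epsilon> l" if "j \<le> m" "l \<le> m" "j < l" for j l
    proof -
      have "s0 j < s0 l"
        using s0(3) that by (simp add: strict_mono_on_def)
      moreover have "((\<lambda>\<epsilon>. p \<epsilon> l - p \<epsilon> j) \<longlongrightarrow> s0 l - s0 j) (at_right 0)"
        by (intro tendsto_diff lim)
      ultimately show ?thesis
        using order_tendstoD(1)[of _ "s0 l - s0 j" "at_right (0::real)" 0] by force
    qed
    then have "\<forall>\<^sub>F \<epsilon> in at_right 0. \<forall>j\<in>{..m}. \<forall>l\<in>{..m}. j < l \<longrightarrow> p \<epsilon> j < p \<epsilon> l"
      by (intro eventually_ball_finite ballI) (auto simp: eventually_mono)
    moreover have "\<forall>\<^sub>F \<epsilon> in at_right 0. \<forall>j\<in>{..m}. p \<epsilon> j < b"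
      using s0(4) by (intro eventually_ball_finite ballI order_tendstoD(2)[OF lim]) auto
    moreover have "\<forall>\<^sub>F \<epsilon> in at_right 0. (0::real) < \<epsilon>"
      by (rule eventually_at_right_less)
    ultimately have "\<forall>\<^sub>F \<epsilon> in at_right 0. L (p \<epsilon>) \<in> texp b ` F \<and> 0 < \<epsilon>"
    proof eventually_elim
      case (elim \<epsilon>)
      then show ?case
        by (intro conjI mem_F) (auto simp: strict_mono_on_def p_def s s0)
    qed
    then obtain \<epsilon> where \<epsilon>: "L (p \<epsilon>) \<in> texp b ` F" "0 < \<epsilon>"
      using eventually_happens'[OF trivial_limit_at_right_real] by blast
    have "y = (1 - 1 / \<epsilon>) *\<^sub>R texp b x + (1 / \<epsilon>) *\<^sub>R L (p \<epsilon>)"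
      unfolding s s0 using \<epsilon>(2) by (simp add: vec_eq_iff L_def p_def field_simps)
    moreover have "texp b x \<in> texp b ` F"
      by (simp add: F_def)
    ultimately show "y \<in> affine hull (texp b ` F)"
      using \<epsilon>(1) by (simp add: mem_affine hull_inc)
  qed
  then have "int m \<le> aff_dim (texp b ` F)"
    using aff_dim_subset A_dim by (metis aff_dim_affine_hull)
  with le show ?thesis
    by (simp add: F_def m_def)
qed

section \<open>Tropical polytopes with real vertices\<close>

definition emb :: "real^'d \<Rightarrow> ereal^'d" where
  "emb x = (\<chi> i. ereal (x $ i))"

lemma homog_emb [simp]: "homog (emb x) i = ereal (rhomog x i)"
  by (cases i) (simp_all add: emb_def zero_ereal_def)

lemma emb_inject [simp]: "emb x = emb y \<longleftrightarrow> x = y"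
  by (auto simp: emb_def vec_eq_iff)

lemma emb_in_trop_space [simp]: "emb x \<in> trop_space"
  by (simp add: emb_def trop_space_def trop_def)

lemma finite_coords_imp_emb:
  assumes "\<And>i. \<bar>homog x i\<bar> \<noteq> \<infinity>"
  obtains y where "x = emb y"
proof
  have "x $ i = ereal (real_of_ereal (x $ i))" for i
    using assms[of "Some i"] by (simp add: ereal_real)
  then show "x = emb (\<chi> i. real_of_ereal (x $ i))"
    by (simp add: emb_def vec_eq_iff)
qed

lemma trop_exp_emb: "trop_exp b (emb x) = texp b x"
  by (simp add: trop_exp_def emb_def texp_def vec_eq_iff)

section \<open>Hulls and covector cells in real coordinates\<close>

definition real_cell :: "('d option \<times> (real^'d)) set \<Rightarrow> (real^'d) set" where
  "real_cell H = {x. \<forall>(i, v)\<in>H. \<forall>k. rhomog v k + rhomog x i \<le> rhomog v i + rhomog x k}"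

text \<open>For real points the coefficient in \<open>mem_tconv_iff\<close> has to be x_i - v_i;
  substituting it leaves the cell inequalities of the pair (i, v).\<close>

definition real_tconv :: "(real^'d) set \<Rightarrow> (real^'d) set" where
  "real_tconv V = {x. \<forall>i. \<exists>v\<in>V. x \<in> real_cell {(i, v)}}"

text \<open>No infinite coordinates arise: coefficients are at most 0, which bounds \<open>x\<close>
  above, and the generator attaining coordinate \<open>None\<close> has coefficient 0 and bounds
  \<open>x\<close> below.\<close>

lemma tconv_emb_image:
  fixes V :: "(real^'d::finite) set"
  shows "tconv (emb ` V) = emb ` real_tconv V"
proof (intro equalityI subsetI)
  fix x assume "x \<in> tconv (emb ` V)"
  then have x: "\<And>i. \<exists>v\<in>V. \<exists>c. (\<forall>k. c + ereal (rhomog v k) \<le> homog x k) \<and> c + ereal (rhomog v i) = homog x i"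
    by (simp add: mem_tconv_iff)
  have "\<bar>homog x i\<bar> \<noteq> \<infinity>" for i
  proof -
    obtain v c where v: "c + ereal (rhomog v i) = homog x i" and c: "c + ereal (rhomog v None) \<le> homog x None"
      using x[of i] by blast
    have "homog x i \<noteq> \<infinity>"
      using v c by (cases c) auto
    moreover obtain w a where w: "a + ereal (rhomog w i) \<le> homog x i" "a + ereal (rhomog w None) = homog x None"
      using x[of None] by blast
    then have "homog x i \<noteq> - \<infinity>"
      by (cases a) auto
    ultimately show ?thesis
      by auto
  qed
  then obtain y where y: "x = emb y"
    by (rule finite_coords_imp_emb)
  have "\<exists>v\<in>V. \<forall>k. rhomog v k + rhomog y i \<le> rhomog v i + rhomog y k" for i
  proof -
    obtain v c where v: "v \<in> V" "\<And>k. c + ereal (rhomog v k) \<le> ereal (rhomog y k)"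
        "c + ereal (rhomog v i) = ereal (rhomog y i)"
      using x[of i] y by auto
    then obtain c' where c': "c = ereal c'"
      by (cases c) auto
    have "rhomog v k + rhomog y i \<le> rhomog v i + rhomog y k" for k
      using v(2)[of k] v(3) by (simp add: c')
    then show ?thesis
      using v(1) by blast
  qed
  then show "x \<in> emb ` real_tconv V"
    unfolding y real_tconv_def real_cell_def by auto
next
  fix x assume "x \<in> emb ` real_tconv V"
  then obtain y where y: "x = emb y" "y \<in> real_tconv V"
    by blast
  show "x \<in> tconv (emb ` V)"
    unfolding mem_tconv_iff
  proof
    fix i
    obtain v where v: "v \<in> V" "\<And>k. rhomog v k + rhomog y i \<le> rhomog v i + rhomog y k"
      using y(2) by (auto simp: real_tconv_def real_cell_def)
    have "(\<forall>k. ereal (rhomog y i - rhomog v i) + homog (emb v) k \<le> homog x k) \<and>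
        ereal (rhomog y i - rhomog v i) + homog (emb v) i = homog x i"
      using v(2) by (simp add: y algebra_simps)
    then show "\<exists>v\<in>emb ` V. \<exists>c. (\<forall>k. c + homog v k \<le> homog x k) \<and> c + homog v i = homog x i"
      using v(1) by blast
  qed
qed

text \<open>A pair (None, v) in \<open>G\<close> makes \<open>v\<close> a coordinatewise lower bound
  of the cell, so -\<infinity> cannot occur in it.\<close>

lemma covector_cell_emb:
  fixes V :: "(real^'d::finite) set"
  assumes G: "G \<subseteq> UNIV \<times> emb ` V" and all: "\<And>i. \<exists>v. (i, v) \<in> G"
  shows "covector_cell G = emb ` real_cell {(i, v). (i, emb v) \<in> G}"
proof (intro equalityI subsetI)
  fix x assume x: "x \<in> covector_cell G"
  have le: "ereal (rhomog v k) + homog x i \<le> ereal (rhomog v i) + homog x k" if "(i, emb v) \<in> G" for i v k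
    using x that by (fastforce simp: covector_cell_def)
  have "\<bar>homog x i\<bar> \<noteq> \<infinity>" for i
  proof -
    obtain v where "(None, emb v) \<in> G"
      using all[of None] G by blast
    then have "homog x i \<noteq> - \<infinity>"
      using le[of None v i] by auto
    moreover have "homog x i \<noteq> \<infinity>"
      using x by (simp add: covector_cell_def homog_neq_PInf)
    ultimately show ?thesis
      by auto
  qed
  then obtain y where y: "x = emb y"
    by (rule finite_coords_imp_emb)
  have "y \<in> real_cell {(i, v). (i, emb v) \<in> G}"
    using le by (auto simp: real_cell_def y)
  then show "x \<in> emb ` real_cell {(i, v). (i, emb v) \<in> G}"
    using y by blast
next
  fix x assume "x \<in> emb ` real_cell {(i, v). (i, emb v) \<in> G}"
  then obtain y where y: "x = emb y" "y \<in> real_cell {(i, v). (i, emb v) \<in> G}"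
    by blast
  have "homog w k + homog x i \<le> homog w i + homog x k" if w: "(i, w) \<in> G" for i w k
  proof -
    obtain v where "w = emb v"
      using w G by blast
    then show ?thesis
      using y w by (auto simp: real_cell_def)
  qed
  then show "x \<in> covector_cell G"
    unfolding covector_cell_def by (auto simp: y(1))
qed

text \<open>With X_i = b^{x_i} and X_0 = 1, the cell inequalities become the linear inequalities
  b^{v_k} X_i <= b^{v_i} X_k.\<close>

lemma convex_texp_real_cell:
  fixes H :: "('d::finite option \<times> (real^'d)) set"
  assumes b: "b > 1"
  shows "convex (texp b ` real_cell H)"
proof (rule convexI)
  fix y y' u w assume "y \<in> texp b ` real_cell H" "y' \<in> texp b ` real_cell H"
    and uw: "0 \<le> (u::real)" "0 \<le> w" "u + w = 1"
  then obtain x x' where x: "y = texp b x" "x \<in> real_cell H" and x': "y' = texp b x'" "x' \<in> real_cell H"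
    by blast
  \<comment> \<open>The convex combination in homogeneous coordinates; \<open>f None = 1\<close>
    because u + w = 1.\<close>
  define f where "f i = u * b powr rhomog x i + w * b powr rhomog x' i" for i
  have f_pos: "f i > 0" for i
  proof (cases "u = 0")
    case True
    then show ?thesis using uw b by (simp add: f_def)
  next
    case False
    then show ?thesis using uw b by (simp add: f_def add_pos_nonneg)
  qed
  define z where "z = (\<chi> i. log b (f (Some i)))"
  have z: "b powr rhomog z i = f i" for i
    using b uw f_pos by (cases i) (simp_all add: z_def, simp add: f_def)
  have le_iff: "p + q \<le> r + s \<longleftrightarrow> b powr p * b powr q \<le> b powr r * b powr s" for p q r s
    using b by (simp flip: powr_add)
  have "z \<in> real_cell H"
    unfolding real_cell_def
  proof (intro CollectI ballI, clarify)
    fix i v k assume iv: "(i, v) \<in> H"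
    have "b powr rhomog v k * b powr rhomog x i \<le> b powr rhomog v i * b powr rhomog x k"
      "b powr rhomog v k * b powr rhomog x' i \<le> b powr rhomog v i * b powr rhomog x' k"
      using x(2) x'(2) iv unfolding real_cell_def le_iff[symmetric] by auto
    then have "u * (b powr rhomog v k * b powr rhomog x i) + w * (b powr rhomog v k * b powr rhomog x' i)
        \<le> u * (b powr rhomog v i * b powr rhomog x k) + w * (b powr rhomog v i * b powr rhomog x' k)"
      using uw by (intro add_mono mult_left_mono)
    then have "b powr rhomog v k * f i \<le> b powr rhomog v i * f k"
      unfolding f_def by (simp add: algebra_simps)
    then show "rhomog v k + rhomog z i \<le> rhomog v i + rhomog z k"
      unfolding le_iff z .
  qed
  moreover have "u *\<^sub>R y + w *\<^sub>R y' = texp b z"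
    using z[of "Some _"] by (simp add: vec_eq_iff x x' texp_def f_def)
  ultimately show "u *\<^sub>R y + w *\<^sub>R y' \<in> texp b ` real_cell H"
    by blast
qed

text \<open>For integral \<open>v\<close> every cell inequality reads x_i - x_k <= n with an integer
  n, so a cell is a union of alcoves.\<close>

lemma alcove_eq_real_cell:
  fixes x y :: "real^'d::finite"
  assumes int: "\<And>i v l. (i, v) \<in> H \<Longrightarrow> v $ l \<in> \<int>"
    and eq: "alcove x = alcove y" and x: "x \<in> real_cell H"
  shows "y \<in> real_cell H"
  unfolding real_cell_def
proof (intro CollectI ballI, clarify)
  fix i v k assume iv: "(i, v) \<in> H"
  have "rhomog v l \<in> \<int>" for l
    using int[OF iv] by (cases l) auto
  then obtain n where n: "rhomog v i - rhomog v k = of_int n"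
    by (metis Ints_diff Ints_cases)
  have "rhomog v k + rhomog x i \<le> rhomog v i + rhomog x k"
    using x iv unfolding real_cell_def by blast
  then have "rhomog x i - rhomog x k \<le> of_int n"
    unfolding n[symmetric] by simp
  then have "rhomog y i - rhomog y k \<le> of_int n"
    by (simp only: alcove_eq_diff_le_iff[OF eq])
  then show "rhomog v k + rhomog y i \<le> rhomog v i + rhomog y k"
    unfolding n[symmetric] by simp
qed

lemma alcove_eq_real_tconv:
  fixes x y :: "real^'d::finite"
  assumes "\<And>v l. v \<in> V \<Longrightarrow> v $ l \<in> \<int>" "alcove x = alcove y" "x \<in> real_tconv V"
  shows "y \<in> real_tconv V"
  unfolding real_tconv_def
proof (intro CollectI allI)
  fix i
  obtain v where v: "v \<in> V" "x \<in> real_cell {(i, v)}"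
    using assms(3) by (auto simp: real_tconv_def)
  have "y \<in> real_cell {(i, v)}"
    by (rule alcove_eq_real_cell[OF _ assms(2) v(2)]) (use assms(1) v(1) in auto)
  then show "\<exists>v\<in>V. y \<in> real_cell {(i, v)}"
    using v(1) by blast
qed

text \<open>The pair for \<open>None\<close> bounds each coordinate below by a vertex coordinate and
  the pair for \<open>i\<close> bounds x_i above. This leaves finitely many integer parts and
  ranks.\<close>

lemma finite_alcoves_real_tconv:
  fixes V :: "(real^'d::finite) set"
  assumes "finite V"
  shows "finite (alcove ` real_tconv V)"
proof -
  define B' where "B' = Max ((\<lambda>(v, i). \<bar>rhomog v i\<bar>) ` (V \<times> UNIV))"
  have "\<bar>rhomog v i\<bar> \<le> B'" if "v \<in> V" for v i
    unfolding B'_def using assms that by (intro Max_ge) force+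
  moreover obtain B :: nat where "B' \<le> real B"
    using real_arch_simple by blast
  ultimately have B: "\<And>v i. v \<in> V \<Longrightarrow> \<bar>rhomog v i\<bar> \<le> real B"
    by (meson order_trans)
  have "alcove x \<in> (UNIV \<rightarrow>\<^sub>E {- int B..int B}) \<times> (UNIV \<rightarrow>\<^sub>E {..CARD('d option)})" if x: "x \<in> real_tconv V" for x
  proof -
    have "\<lfloor>rhomog x i\<rfloor> \<in> {- int B..int B}" for i
    proof -
      obtain v where "v \<in> V" "rhomog v i \<le> rhomog x i"
        using x by (force simp: real_tconv_def real_cell_def dest: spec[of _ None])
      moreover obtain w where "w \<in> V" "rhomog x i \<le> rhomog w i"
        using x by (force simp: real_tconv_def real_cell_def dest: spec[of _ i] spec[of _ None])
      ultimately have "- real B \<le> rhomog x i" "rhomog x i \<le> real B"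
        using B[of v i] B[of w i] by linarith+
      then show ?thesis
        by (simp add: le_floor_iff floor_le_iff)
    qed
    moreover have "frac_rank x i \<le> CARD('d option)" for i
    proof -
      have "frac_rank x i < card (fracs x)"
        using range_frac_rank[of x] by blast
      also have "\<dots> \<le> CARD('d option)"
        unfolding fracs_def by (rule card_image_le) simp
      finally show ?thesis
        by simp
    qed
    ultimately show ?thesis
      by (simp add: alcove_def PiE_UNIV_domain)
  qed
  then have "alcove ` real_tconv V \<subseteq> (UNIV \<rightarrow>\<^sub>E {- int B..int B}) \<times> (UNIV \<rightarrow>\<^sub>E {..CARD('d option)})"
    by blast
  then show ?thesis
    by (rule finite_subset) (intro finite_cartesian_product finite_PiE; simp)
qed

section \<open>Counting polynomials\<close>

text \<open>(k-1)(k-2)...(k-m)/m!, the Ehrhart polynomial of the open unimodular simplex of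
  dimension m.\<close>

definition open_simplex_poly :: "nat \<Rightarrow> real poly" where
  "open_simplex_poly m = smult (1 / fact m) (\<Prod>i<m. [:- real (Suc i), 1:])"

lemma degree_open_simplex_poly [simp]: "degree (open_simplex_poly m) = m"
  by (simp add: open_simplex_poly_def degree_prod_sum_eq)

lemma lead_coeff_open_simplex_poly_pos: "coeff (open_simplex_poly m) m > 0"
proof -
  have "lead_coeff (open_simplex_poly m) > 0"
    unfolding open_simplex_poly_def lead_coeff_smult lead_coeff_prod by simp
  then show ?thesis
    by simp
qed

lemma poly_open_simplex_poly:
  assumes "k > 0"
  shows "poly (open_simplex_poly m) (real k) = real ((k - 1) choose m)"
proof -
  have "real (k - 1) = real k - 1"
    using assms by simp
  then show ?thesis
    by (simp add: open_simplex_poly_def poly_prod binomial_gbinomial gbinomial_prod_rev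
        atLeast0LessThan algebra_simps)
qed

text \<open>Nothing cancels in the top degree: there each summand has coefficient 0 or its positive
  leading coefficient.\<close>

lemma degree_sum_lead_coeff_pos:
  fixes p :: "'a \<Rightarrow> real poly"
  assumes "finite S" "S \<noteq> {}" and pos: "\<And>c. c \<in> S \<Longrightarrow> lead_coeff (p c) > 0"
  shows "degree (\<Sum>c\<in>S. p c) = Max ((\<lambda>c. degree (p c)) ` S)"
proof (rule antisym)
  define M where "M = Max ((\<lambda>c. degree (p c)) ` S)"
  have le: "degree (p c) \<le> M" if "c \<in> S" for c
    unfolding M_def using assms(1) that by simp
  show "degree (\<Sum>c\<in>S. p c) \<le> Max ((\<lambda>c. degree (p c)) ` S)"
    using le assms(1) by (intro degree_sum_le) (simp_all flip: M_def)
  have "M \<in> (\<lambda>c. degree (p c)) ` S"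
    unfolding M_def using assms by (intro Max_in) auto
  then obtain c0 where c0: "c0 \<in> S" "degree (p c0) = M"
    by blast
  have "coeff (p c) M \<ge> 0" if "c \<in> S" for c
    using le[OF that] pos[OF that] by (cases "degree (p c) = M") (auto simp: coeff_eq_0)
  moreover have "coeff (p c0) M > 0"
    using pos c0 by auto
  ultimately have "coeff (\<Sum>c\<in>S. p c) M > 0"
    unfolding coeff_sum using assms(1) c0 by (intro sum_pos2[of S c0]) auto
  then show "Max ((\<lambda>c. degree (p c)) ` S) \<le> degree (\<Sum>c\<in>S. p c)"
    unfolding M_def[symmetric] by (intro le_degree) simp
qed

text \<open>Lattice points of the dilate are the points x of \<open>R\<close> with k x integral. As
  \<open>R\<close> is a disjoint union of finitely many alcoves, they are counted alcove by
  alcove.\<close>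

lemma dilate_emb_int_lattice:
  fixes R :: "(real^'d::finite) set"
  assumes R: "\<And>x y. x \<in> R \<Longrightarrow> alcove x = alcove y \<Longrightarrow> y \<in> R"
    and fin: "finite (alcove ` R)" and k: "k > 0"
  shows "finite (dilate k (emb ` R) \<inter> int_lattice)"
    "card (dilate k (emb ` R) \<inter> int_lattice) = (\<Sum>c\<in>alcove ` R. (k - 1) choose alcove_dim c)"
proof -
  define L where "L c = {y :: real^'d. alcove y = c \<and> (\<forall>i. real k * y $ i \<in> \<int>)}" for c
  define h where "h x = (\<chi> i. ereal (real k * x $ i))" for x :: "real^'d"
  have L: "finite (L c) \<and> card (L c) = (k - 1) choose alcove_dim c" if "c \<in> alcove ` R" for c
    using that card_alcove_lattice_points[OF k] unfolding L_def by auto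
  have "inj h"
    using k by (auto simp: inj_def h_def vec_eq_iff)
  have mem: "h x \<in> int_lattice \<longleftrightarrow> (\<forall>i. real k * x $ i \<in> \<int>)" for x
    by (simp add: h_def int_lattice_def Ints_def image_iff)
  have "dilate k (emb ` R) = h ` R"
    by (auto simp: dilate_def h_def emb_def image_image)
  also have "\<dots> \<inter> int_lattice = h ` {x \<in> R. \<forall>i. real k * x $ i \<in> \<int>}"
    using mem by blast
  also have "{x \<in> R. \<forall>i. real k * x $ i \<in> \<int>} = (\<Union>c\<in>alcove ` R. L c)"
    using R by (fastforce simp: L_def)
  finally have eq: "dilate k (emb ` R) \<inter> int_lattice = h ` (\<Union>c\<in>alcove ` R. L c)" .
  show "finite (dilate k (emb ` R) \<inter> int_lattice)"
    unfolding eq using fin L by blast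
  have "card (dilate k (emb ` R) \<inter> int_lattice) = card (\<Union>c\<in>alcove ` R. L c)"
    unfolding eq using \<open>inj h\<close> by (simp add: card_image inj_on_subset)
  also have "\<dots> = (\<Sum>c\<in>alcove ` R. card (L c))"
    using fin L by (intro card_UN_disjoint) (auto simp: L_def)
  also have "\<dots> = (\<Sum>c\<in>alcove ` R. (k - 1) choose alcove_dim c)"
    using L by (intro sum.cong) auto
  finally show "card (dilate k (emb ` R) \<inter> int_lattice) = (\<Sum>c\<in>alcove ` R. (k - 1) choose alcove_dim c)" .
qed

section \<open>The dimension of the covector decomposition\<close>

text \<open>No cell exceeds the largest alcove dimension, since its convex image lies in the affine
  hull of the image of one alcove. The bound is reached by the cell belonging to the full covector
  of a point in a largest alcove.\<close>

lemma trop_dim_eq_Max_alcove_dim: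
  fixes V :: "(real^'d::finite) set"
  assumes b: "b > 1" and fin: "finite V" and int: "\<And>v l. v \<in> V \<Longrightarrow> v $ l \<in> \<int>"
    and ne: "real_tconv V \<noteq> {}" and vert: "tvertices P = emb ` V"
  shows "trop_dim b P = int (Max (alcove_dim ` alcove ` real_tconv V))"
proof -
  define R where "R = real_tconv V"
  define S where "S = alcove ` R"
  define M where "M = Max (alcove_dim ` S)"
  define D where "D = covector_decomposition P"
  have finS: "finite S"
    unfolding S_def R_def by (rule finite_alcoves_real_tconv[OF fin])
  have dimF: "aff_dim (texp b ` {y. alcove y = c}) = int (alcove_dim c)" if "c \<in> S" for c
    using that aff_dim_texp_alcove[OF b] by (auto simp: S_def)
  have le_M: "alcove_dim c \<le> M" if "c \<in> S" for c
    unfolding M_def using that finS by simp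
  have "D \<subseteq> covector_cell ` Pow (UNIV \<times> emb ` V)"
    by (auto simp: D_def covector_decomposition_def vert)
  then have finD: "finite D"
    by (rule finite_subset) (use fin in simp)
  have upper: "aff_dim (trop_exp b ` C) \<le> int M" if C: "C \<in> D" for C
  proof -
    obtain G where G: "C = covector_cell G" "G \<subseteq> UNIV \<times> emb ` V" "covector_cell G \<noteq> {}" "\<And>i. \<exists>v. (i, v) \<in> G"
      using C by (auto simp: D_def covector_decomposition_def vert)
    define K where "K = real_cell {(i, v). (i, emb v) \<in> G}"
    have CK: "C = emb ` K"
      unfolding K_def G(1) by (rule covector_cell_emb[OF G(2,4)])
    then have img: "trop_exp b ` C = texp b ` K"
      by (simp add: image_image trop_exp_emb)
    have "K \<subseteq> R"
    proof
      fix x assume x: "x \<in> K"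
      have "\<exists>v\<in>V. x \<in> real_cell {(i, v)}" for i
      proof -
        obtain v where "v \<in> V" "(i, emb v) \<in> G"
          using G(2,4) by blast
        then show ?thesis
          using x by (auto simp: K_def real_cell_def)
      qed
      then show "x \<in> R"
        by (simp add: R_def real_tconv_def)
    qed
    then have "texp b ` K \<subseteq> (\<Union>c\<in>S. affine hull (texp b ` {y. alcove y = c}))"
      by (force simp: S_def intro: hull_inc)
    moreover have "convex (texp b ` K)" "texp b ` K \<noteq> {}"
      using convex_texp_real_cell[OF b] G(1,3) CK by (auto simp: K_def)
    ultimately obtain c where c: "c \<in> S" "texp b ` K \<subseteq> affine hull (texp b ` {y. alcove y = c})"
      using convex_subset_finite_affine_cover[OF finS] affine_affine_hull by meson
    then have "aff_dim (texp b ` K) \<le> int (alcove_dim c)"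
      using aff_dim_subset dimF by (metis aff_dim_affine_hull)
    then show ?thesis
      using le_M[OF c(1)] img by simp
  qed
  have "M \<in> alcove_dim ` S"
    unfolding M_def using finS ne by (intro Max_in) (auto simp: S_def R_def)
  then obtain x where x: "x \<in> R" "alcove_dim (alcove x) = M"
    by (auto simp: S_def)
  \<comment> \<open>The covector of \<open>x\<close>: all pairs whose inequalities hold at
    \<open>x\<close>.\<close>
  define H where "H = {(i, v). v \<in> V \<and> x \<in> real_cell {(i, v)}}"
  define G where "G = (\<lambda>(i, v). (i, emb v)) ` H"
  have G_iff: "(i, emb v) \<in> G \<longleftrightarrow> (i, v) \<in> H" for i v
    by (auto simp: G_def)
  have G1: "G \<subseteq> UNIV \<times> emb ` V"
    by (auto simp: G_def H_def)
  have G2: "\<exists>v. (i, v) \<in> G" for i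
  proof -
    obtain v where "v \<in> V" "x \<in> real_cell {(i, v)}"
      using x(1) by (auto simp: R_def real_tconv_def)
    then show ?thesis
      using G_iff by (auto simp: H_def)
  qed
  have G3: "\<exists>i. (i, emb v) \<in> G" if v: "v \<in> V" for v
  proof -
    \<comment> \<open>At a minimum of x_i - v_i all inequalities of (i, v) hold, so every vertex
      occurs in the covector.\<close>
    define i where "i = arg_min_on (\<lambda>i. rhomog x i - rhomog v i) UNIV"
    have "rhomog x i - rhomog v i \<le> rhomog x k - rhomog v k" for k
      unfolding i_def by (rule arg_min_least) auto
    then have "rhomog v k + rhomog x i \<le> rhomog v i + rhomog x k" for k
      by (simp add: algebra_simps)
    then have "(i, v) \<in> H"
      using v by (auto simp: H_def real_cell_def)
    then show ?thesis
      using G_iff by blast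
  qed
  have cell: "covector_cell G = emb ` real_cell H"
    using covector_cell_emb[OF G1 G2] by (simp add: G_iff)
  have xH: "x \<in> real_cell H"
    by (auto simp: H_def real_cell_def)
  have inD: "covector_cell G \<in> D"
    unfolding D_def covector_decomposition_def vert
    using G1 G2 G3 xH cell by (auto intro!: exI[of _ G])
  have "{y. alcove y = alcove x} \<subseteq> real_cell H"
    using alcove_eq_real_cell[of H x] xH int by (auto simp: H_def)
  then have "texp b ` {y. alcove y = alcove x} \<subseteq> trop_exp b ` covector_cell G"
    unfolding cell by (auto simp: image_image trop_exp_emb)
  then have "int M \<le> aff_dim (trop_exp b ` covector_cell G)"
    using aff_dim_subset aff_dim_texp_alcove[OF b, of x] x(2) by metis
  then have "aff_dim (trop_exp b ` covector_cell G) = int M"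
    using upper[OF inD] by simp
  then have "Max ((\<lambda>C. aff_dim (trop_exp b ` C)) ` D) = int M"
    using finD upper inD by (intro Max_eqI) (auto simp: image_iff intro!: bexI[of _ "covector_cell G"])
  then show ?thesis
    by (simp add: trop_dim_def D_def M_def S_def R_def)
qed

section \<open>Assembling the polynomial\<close>

theorem theorem3p4:
  fixes P :: "(ereal^'d::finite) set" and b :: real
  assumes "canonical_tropical_lattice_polytope P"
    and "finite (P \<inter> int_lattice)" and "P \<inter> int_lattice \<noteq> {}"
    and "b > 1"
  shows "\<exists>p :: real poly.
           int (degree p) = trop_dim b P \<and>
           (\<forall>k::nat. k > 0 \<longrightarrow>
              finite (dilate k P \<inter> int_lattice) \<and>
              real (card (dilate k P \<inter> int_lattice)) = poly p (real k))"
proof -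
  have poly: "tropical_polytope P"
    using assms(1) by (simp add: canonical_tropical_lattice_polytope_def)
  define V where "V = {v. emb v \<in> tvertices P}"
  have coord: "\<exists>m::int. w $ i = ereal (real_of_int m)" if "w \<in> tvertices P" for w i
    using tvertices_finite_coords[OF assms(1-3) that] .
  have "w \<in> emb ` V" if w: "w \<in> tvertices P" for w
  proof -
    obtain m :: "'d \<Rightarrow> int" where "\<And>i. w $ i = ereal (real_of_int (m i))"
      using coord[OF w] by metis
    then have "w = emb (\<chi> i. real_of_int (m i))"
      by (simp add: emb_def vec_eq_iff)
    then show ?thesis
      using w by (auto simp: V_def)
  qed
  then have vert: "tvertices P = emb ` V"
    by (auto simp: V_def)
  have finV: "finite V"
    using tropical_polytope_tvertices(2)[OF poly] unfolding vert
    by (rule finite_imageD) (simp add: inj_on_def)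
  have int: "v $ l \<in> \<int>" if v: "v \<in> V" for v l
  proof -
    obtain m :: int where "emb v $ l = ereal (real_of_int m)"
      using coord v by (auto simp: V_def)
    then show ?thesis
      by (simp add: emb_def)
  qed
  define R where "R = real_tconv V"
  have "tconv (tvertices P) = P"
    using tropical_polytope_tvertices(1)[OF poly] by (simp add: minimal_generating_set_def)
  then have P: "P = emb ` R"
    by (simp add: vert tconv_emb_image R_def)
  have R: "y \<in> R" if "x \<in> R" "alcove x = alcove y" for x y
    using alcove_eq_real_tconv[of V x y] int that unfolding R_def by blast
  have finS: "finite (alcove ` R)"
    unfolding R_def by (rule finite_alcoves_real_tconv[OF finV])
  have R_ne: "R \<noteq> {}"
    using assms(3) P by auto
  \<comment> \<open>One open simplex polynomial for each alcove of the polytope.\<close>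
  define p where "p = (\<Sum>c\<in>alcove ` R. open_simplex_poly (alcove_dim c))"
  have "degree p = Max (alcove_dim ` alcove ` R)"
    unfolding p_def using finS R_ne
    by (subst degree_sum_lead_coeff_pos) (auto simp: lead_coeff_open_simplex_poly_pos image_image)
  moreover have "trop_dim b P = int (Max (alcove_dim ` alcove ` R))"
    using trop_dim_eq_Max_alcove_dim[OF assms(4) finV int _ vert] R_ne by (simp add: R_def)
  moreover have "finite (dilate k P \<inter> int_lattice) \<and>
      real (card (dilate k P \<inter> int_lattice)) = poly p (real k)" if "k > 0" for k
    using dilate_emb_int_lattice[OF R finS that] that
    by (simp add: P p_def poly_sum poly_open_simplex_poly)
  ultimately show ?thesis
    by (intro exI[of _ p]) auto
qed

end
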